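(* For the $\mathrm{EFS}^{\Delta}$ share, $\alpha(n,\cdot)=\Theta(\sqrt{\Delta})$, where the upper bound holds for any sets of unknown agents that the agents choose, and in the lower bound instance the lower bound holds for all possible such sets. That is, there are absolute constants $K,c>0$ such that for every integer $n\ge1$ and every $\Delta$ with $1\le\Delta\le n$: (i) $c\sqrt{\Delta}\le\alpha(n,\cdot)\le K\sqrt{\Delta}$ for the share $\mathrm{EFS}^{\Delta}_i(\mathcal{I})$; (ii) for every $m\ge1$, every instance $\mathcal{I}=\langle[n],[m],V\rangle$ and every choice of sets $W_i\subseteq[n]\setminus\{i\}$ with $|W_i|=\lfloor\frac{n-1}{\Delta}\rfloor$ ($i\in[n]$), there is an allocation $\mathcal{A}\in\mathcal{P}(n,m)$ with $u_i(A_i)\ge\frac{1}{K\sqrt{\Delta}}\,\mathrm{EFS}^{\Delta}_i(\mathcal{I},W_i)$ for all $i\in[n]$; (iii) there are an $m\ge1$ and an instance $\mathcal{I}=\langle[n],[m],V\rangle$ such that for every choice of sets $W_i\subseteq[n]\setminus\{i\}$ with $|W_i|=\lfloor\frac{n-1}{\Delta}\rfloor$ ($i\in[n]$), whenever $\alpha\ge1$ and an allocation $\mathcal{A}\in\mathcal{P}(n,m)$ satisfy $u_i(A_i)\ge\mathrm{EFS}^{\Delta}_i(\mathcal{I},W_i)/\alpha$ for all $i\in[n]$, then $\alpha\ge c\sqrt{\Delta}$.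
   Context: A fair division instance $\mathcal{I}=\langle [n],[m],V\rangle$ consists of $n$ agents, $m$ homogeneous divisible items, and valuations $V=(v_1,\dots,v_n)$, where $v_{ik}\ge 0$ is agent $i$'s value for all of item $k$. A bundle is a vector $B\in[0,1]^m$, and $u_i(B)=\sum_{k\in[m]} v_{ik}B(k)$. An allocation is a tuple $\mathcal{A}=(A_1,\dots,A_n)$ of bundles with $\sum_{i\in[n]}A_i(k)\le 1$ for every $k\in[m]$; $\mathcal{P}(n,m)$ is the set of all allocations. For an agent $i$ and a set $W_i\subseteq[n]\setminus\{i\}$ with $|W_i|=\lfloor\frac{n-1}{\Delta}\rfloor$ (the agents whose utility functions are unknown to $i$), $\mathrm{EFS}^{\Delta}_i(\mathcal{I},W_i)=\max u_i(A_i)$ over all $\mathcal{A}\in\mathcal{P}(n,m)$ such that $u_j(A_i)\le u_j(A_j)$ for all $j\in[n]\setminus(W_i\cup\{i\})$ and $A_j=A_i$ for all $j\in W_i$. The $\mathrm{EFS}^{\Delta}$ share of agent $i$ is $\mathrm{EFS}^{\Delta}_i(\mathcal{I})=\mathbb{E}_{W_i}[\mathrm{EFS}^{\Delta}_i(\mathcal{I},W_i)]$, with $W_i$ uniformly random among subsets of $[n]\setminus\{i\}$ of size $\lfloor\frac{n-1}{\Delta}\rfloor$. For a notion of share assigning a value $s_i(\mathcal{I})$ to each agent, $\alpha(n,m)$ is the smallest $\alpha\ge1$ such that every instance with $n$ agents and $m$ items has an allocation with $u_i(A_i)\ge s_i(\mathcal{I})/\alpha$ for all $i$; $\alpha(n,\cdot)$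 is the worst case (supremum) of $\alpha(n,m)$ over all $m$. *)

theory Defs
  imports "HOL-Probability.Probability"
begin

text \<open>
  Agents are \<open>{1..n}\<close> and items are \<open>{1..m}\<close>. Valuations, bundles and allocations are total
  functions on \<open>nat\<close> of which only the values at these indices matter.
\<close>

type_synonym valuations = "nat \<Rightarrow> nat \<Rightarrow> real"
type_synonym item_bundle = "nat \<Rightarrow> real"
type_synonym allocation = "nat \<Rightarrow> item_bundle"

definition fair_instance :: "nat \<Rightarrow> nat \<Rightarrow> valuations \<Rightarrow> bool" where
  "fair_instance n m v \<longleftrightarrow> (\<forall>i\<in>{1..n}. \<forall>k\<in>{1..m}. 0 \<le> v i k)"

definition is_bundle :: "nat \<Rightarrow> item_bundle \<Rightarrow> bool" where
  "is_bundle m B \<longleftrightarrow> (\<forall>k\<in>{1..m}. 0 \<le> B k \<and> B k \<le> 1)"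

definition utility :: "nat \<Rightarrow> valuations \<Rightarrow> nat \<Rightarrow> item_bundle \<Rightarrow> real" where
  "utility m v i B = (\<Sum>k\<in>{1..m}. v i k * B k)"

definition allocations :: "nat \<Rightarrow> nat \<Rightarrow> allocation set" where
  "allocations n m = {A. (\<forall>i\<in>{1..n}. is_bundle m (A i)) \<and>
                         (\<forall>k\<in>{1..m}. (\<Sum>i\<in>{1..n}. A i k) \<le> 1)}"

definition unknown_sets :: "nat \<Rightarrow> real \<Rightarrow> nat \<Rightarrow> nat set set" where
  "unknown_sets n \<Delta> i =
     {W. W \<subseteq> {1..n} - {i} \<and> int (card W) = \<lfloor>(real n - 1) / \<Delta>\<rfloor>}"

definition EFS_feasible :: "nat \<Rightarrow> nat \<Rightarrow> valuations \<Rightarrow> nat \<Rightarrow> nat set \<Rightarrow> allocation set" where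
  "EFS_feasible n m v i W =
     {A \<in> allocations n m.
        (\<forall>j\<in>{1..n} - (W \<union> {i}). utility m v j (A i) \<le> utility m v j (A j)) \<and>
        (\<forall>j\<in>W. \<forall>k\<in>{1..m}. A j k = A i k)}"

text \<open>The supremum below is a maximum; see \<open>EFS_given_is_max\<close>.\<close>

definition EFS_given :: "nat \<Rightarrow> nat \<Rightarrow> valuations \<Rightarrow> nat \<Rightarrow> nat set \<Rightarrow> real" where
  "EFS_given n m v i W = (SUP A\<in>EFS_feasible n m v i W. utility m v i (A i))"

definition EFS :: "real \<Rightarrow> nat \<Rightarrow> nat \<Rightarrow> valuations \<Rightarrow> nat \<Rightarrow> real" where
  "EFS \<Delta> n m v i =
     measure_pmf.expectation (pmf_of_set (unknown_sets n \<Delta> i)) (\<lambda>W. EFS_given n m v i W)"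

text \<open>
  A notion of share maps \<open>n\<close>, \<open>m\<close>, the valuations and an agent to a real number. The ratios are
  extended reals, so that the ratio is \<open>\<infinity>\<close> when no real \<open>\<alpha>\<close> is admissible or when it is unbounded
  in \<open>m\<close>.
\<close>

type_synonym share = "nat \<Rightarrow> nat \<Rightarrow> valuations \<Rightarrow> nat \<Rightarrow> real"

definition approx_ratio :: "share \<Rightarrow> nat \<Rightarrow> nat \<Rightarrow> ereal" where
  "approx_ratio s n m =
     Inf {ereal \<alpha> | \<alpha>. 1 \<le> \<alpha> \<and>
       (\<forall>v. fair_instance n m v \<longrightarrow>
          (\<exists>A\<in>allocations n m. \<forall>i\<in>{1..n}. utility m v i (A i) \<ge> s n m v i / \<alpha>))}"

definition worst_approx_ratio :: "share \<Rightarrow> nat \<Rightarrow> ereal" where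
  "worst_approx_ratio s n = (SUP m\<in>{1..}. approx_ratio s n m)"

lemma unknown_sets_finite: "finite (unknown_sets n \<Delta> i)"
  unfolding unknown_sets_def by (rule finite_subset[of _ "Pow {1..n}"]) auto

lemma unknown_sets_nonempty:
  assumes "i \<in> {1..n}" and "1 \<le> \<Delta>"
  shows "unknown_sets n \<Delta> i \<noteq> {}"
proof -
  have n: "n \<ge> 1" using assms by auto
  define w where "w = nat \<lfloor>(real n - 1) / \<Delta>\<rfloor>"
  have nn: "0 \<le> (real n - 1) / \<Delta>" using n assms by simp
  have "(real n - 1) / \<Delta> \<le> real n - 1"
    using n assms by (simp add: divide_le_eq mult_le_cancel_left1)
  hence "\<lfloor>(real n - 1) / \<Delta>\<rfloor> \<le> int n - 1"
    by linarith
  hence "w \<le> card ({1..n} - {i})"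
    using assms n by (simp add: w_def)
  then obtain W where "W \<subseteq> {1..n} - {i}" "card W = w"
    by (meson obtain_subset_with_card_n)
  moreover have "int w = \<lfloor>(real n - 1) / \<Delta>\<rfloor>" using nn by (simp add: w_def)
  ultimately show ?thesis by (auto simp: unknown_sets_def)
qed

lemma zero_EFS_feasible:
  "(\<lambda>_ _. 0) \<in> EFS_feasible n m v i W"
  by (auto simp: EFS_feasible_def allocations_def is_bundle_def utility_def)

lemma EFS_given_is_max:
  assumes i: "i \<in> {1..n}" and W: "W \<subseteq> {1..n}"
  shows "\<exists>A\<in>EFS_feasible n m v i W. utility m v i (A i) = EFS_given n m v i W \<and>
           (\<forall>A'\<in>EFS_feasible n m v i W. utility m v i (A' i) \<le> utility m v i (A i))"
proof -
  let ?F = "EFS_feasible n m v i W"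
  define T :: "nat \<Rightarrow> nat \<Rightarrow> real set"
    where "T j k = (if j \<in> {1..n} \<and> k \<in> {1..m} then {0..1} else {0})" for j k
  define r :: "allocation \<Rightarrow> allocation"
    where "r A = (\<lambda>j k. if j \<in> {1..n} \<and> k \<in> {1..m} then A j k else 0)" for A
  define box :: "allocation set" where "box = {A. \<forall>j k. A j k \<in> T j k}"
  have cT: "compact (T j k)" for j k by (auto simp: T_def)
  have c1: "compact (PiE UNIV (T j))" for j
    using cT compactin_PiE[where X="\<lambda>_. euclidean" and I=UNIV and S="T j"]
    by (simp add: euclidean_product_topology)
  have "compact (PiE UNIV (\<lambda>j. PiE UNIV (T j)))"
    using c1 compactin_PiE[where X="\<lambda>_. euclidean" and I=UNIV and S="\<lambda>j. PiE UNIV (T j)"]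
    by (simp add: euclidean_product_topology)
  moreover have "box = PiE UNIV (\<lambda>j. PiE UNIV (T j))"
    by (auto simp: box_def PiE_iff)
  ultimately have cbox: "compact box" by simp
  have coord: "continuous_on UNIV (\<lambda>A::allocation. A j k)" for j k
    using continuous_on_product_then_coordinatewise[OF continuous_on_product_coordinates] .
  have ucont: "continuous_on UNIV (\<lambda>A::allocation. utility m v j (A l))" for j l
    unfolding utility_def by (intro continuous_intros coord)
  define C where "C = (\<Inter>k\<in>{1..m}. {A::allocation. (\<Sum>i\<in>{1..n}. A i k) \<le> 1})
    \<inter> (\<Inter>j\<in>{1..n} - (W \<union> {i}). {A. utility m v j (A i) \<le> utility m v j (A j)})
    \<inter> (\<Inter>j\<in>W. \<Inter>k\<in>{1..m}. {A. A j k = A i k})"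
  have "closed C"
    unfolding C_def
    by (intro closed_Int closed_INT ballI closed_Collect_le closed_Collect_eq
        continuous_intros coord ucont)
  hence comp: "compact (box \<inter> C)" using cbox by (rule compact_Int_closed[rotated])
  have sub: "box \<inter> C \<subseteq> ?F"
    by (force simp: box_def C_def T_def EFS_feasible_def allocations_def is_bundle_def
        split: if_splits)
  have ne: "box \<inter> C \<noteq> {}"
  proof -
    have "(\<lambda>_ _. 0) \<in> box \<inter> C" by (auto simp: box_def C_def T_def utility_def)
    thus ?thesis by blast
  qed
  have r_util: "utility m v j (r A l) = utility m v j (A l)" if "l \<in> {1..n}" for j l A
    using that by (auto simp: utility_def r_def intro!: sum.cong)
  have r_mem: "r A \<in> box \<inter> C" if A: "A \<in> ?F" for A
  proof
    show "r A \<in> box"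
      using A by (auto simp: box_def r_def T_def EFS_feasible_def allocations_def is_bundle_def)
    have "(\<Sum>i\<in>{1..n}. r A i k) \<le> 1" if "k \<in> {1..m}" for k
      using A that by (auto simp: r_def EFS_feasible_def allocations_def)
    moreover have "utility m v j (r A i) \<le> utility m v j (r A j)" if "j \<in> {1..n} - (W \<union> {i})" for j
      using A that i r_util by (auto simp: EFS_feasible_def)
    moreover have "r A j k = r A i k" if "j \<in> W" "k \<in> {1..m}" for j k
    proof -
      have "j \<in> {1..n}" using that W by blast
      thus ?thesis using A that i by (auto simp: EFS_feasible_def r_def)
    qed
    ultimately show "r A \<in> C" unfolding C_def by blast
  qed
  obtain A where A: "A \<in> box \<inter> C"
    and mx: "\<And>A'. A' \<in> box \<inter> C \<Longrightarrow> utility m v i (A' i) \<le> utility m v i (A i)"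
    using continuous_attains_sup[OF comp ne continuous_on_subset[OF ucont[of i i]]] by blast
  have mx': "utility m v i (A' i) \<le> utility m v i (A i)" if "A' \<in> ?F" for A'
    using mx[OF r_mem[OF that]] r_util[OF i] by simp
  have AF: "A \<in> ?F" using A sub by blast
  have "EFS_given n m v i W = utility m v i (A i)"
    unfolding EFS_given_def by (rule cSup_eq_maximum) (use AF mx' in auto)
  with AF mx' show ?thesis by metis
qed

end

theory Submission
  imports Defs
begin

text \<open>
  Upper bound. By duality (lemma \<open>approachability\<close>: moving towards a best response to the current
  deficits decreases the sum of their squares) it suffices to find, for all weights \<open>y \<ge> 0\<close>, an
  allocation with \<open>\<Sum> y\<^sub>i u\<^sub>i(A\<^sub>i) \<ge> \<Sum> y\<^sub>i E\<^sub>i / O(\<surd>\<Delta>)\<close>, where \<open>E\<^sub>i\<close> is the share of agent \<open>i\<close>. The best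
  one has value \<open>P = \<Sum> p\<^sub>k\<close> with \<open>p\<^sub>k = max y\<^sub>i v\<^sub>i\<^sub>k\<close>. If \<open>B\<^sub>i\<close> is the bundle of agent \<open>i\<close> in an
  allocation defining \<open>E\<^sub>i\<close>, then the value of that allocation bounds \<open>\<Sum>\<^sub>j y\<^sub>j u\<^sub>j(B\<^sub>i)\<close> by \<open>P\<close>, as no
  agent envies \<open>i\<close>, and \<open>B\<^sub>i \<le> 2\<Delta>/n\<close>, as agent \<open>i\<close> and the unknown agents get equal bundles. With
  \<open>a\<^sub>i\<^sub>k = y\<^sub>i v\<^sub>i\<^sub>k\<close>, the sum \<open>\<Sum>\<^sub>i a\<^sub>i\<^sub>k B\<^sub>i(k)\<close> is at most both \<open>p\<^sub>k \<Sum>\<^sub>i B\<^sub>i(k)\<close> and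
  \<open>(2\<Delta>/n) \<Sum>\<^sub>j a\<^sub>j\<^sub>k\<close>, so Cauchy--Schwarz over \<open>k\<close> gives \<open>\<Sum> y\<^sub>i E\<^sub>i \<le> \<surd>(2\<Delta>) P\<close>.

  Lower bound. Each of about \<open>\<surd>\<Delta>\<close> groups of about \<open>n/\<surd>\<Delta>\<close> agents has an item that only it values,
  at \<open>w + 1\<close> for \<open>w\<close> unknown agents, and a common item is worth about \<open>n/\<surd>\<Delta>\<close> to everyone. Every
  share is at least 1: the common item compensates the rest of the agent's group, while the other
  groups do not value the bundle. The total welfare is \<open>O(n/\<surd>\<Delta>)\<close>.
\<close>

section \<open>Two analytic tools: approaching a target vector, and a bound on sums of
  products\<close>

text \<open>The infimum \<open>J\<close> of the sum of squared deficits is 0: if it were positive, a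
  short step from a near-minimal point towards a best response to its deficits would fall below
  \<open>J\<close>. A point with sum below \<open>\<epsilon>\<^sup>2\<close> then misses each target
  by less than \<open>\<epsilon>\<close>. Since \<open>S\<close> is not assumed closed, the infimum
  need not be attained, hence the slack \<open>\<epsilon>\<close>.\<close>

lemma approachability:
  fixes S :: "('a \<Rightarrow> real) set" and b :: "'a \<Rightarrow> real"
  assumes fin: "finite I"
    and conv: "\<And>u u' t. u \<in> S \<Longrightarrow> u' \<in> S \<Longrightarrow> 0 \<le> t \<Longrightarrow> t \<le> 1 \<Longrightarrow>
        \<exists>z\<in>S. \<forall>i\<in>I. z i = u i + t * (u' i - u i)"
    and bdd: "\<And>u i. u \<in> S \<Longrightarrow> i \<in> I \<Longrightarrow> \<bar>u i\<bar> \<le> M"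
    and resp: "\<And>y. (\<And>i. i \<in> I \<Longrightarrow> 0 \<le> y i) \<Longrightarrow>
        \<exists>u\<in>S. (\<Sum>i\<in>I. y i * b i) \<le> (\<Sum>i\<in>I. y i * u i)"
    and eps: "0 < \<epsilon>"
  shows "\<exists>u\<in>S. \<forall>i\<in>I. b i - \<epsilon> \<le> u i"
proof -
  define \<Phi> where "\<Phi> u = (\<Sum>i\<in>I. (max 0 (b i - u i))\<^sup>2)" for u
  define J where "J = (INF u\<in>S. \<Phi> u)"
  have ne: "S \<noteq> {}" using resp[of "\<lambda>_. 0"] by auto
  have below: "bdd_below (\<Phi> ` S)"
    by (rule bdd_belowI2[of _ 0]) (simp add: \<Phi>_def sum_nonneg)
  have J_le: "J \<le> \<Phi> u" if "u \<in> S" for u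
    unfolding J_def using below that by (rule cINF_lower)
  have J_near: "\<exists>u\<in>S. \<Phi> u < J + e" if "0 < e" for e
    using cINF_less_iff[OF ne below, of "J + e"] that by (simp add: J_def)
  have J_ge0: "0 \<le> J"
    unfolding J_def by (rule cINF_greatest[OF ne]) (simp add: \<Phi>_def sum_nonneg)
  have "J = 0"
  proof (rule ccontr)
    assume "J \<noteq> 0"
    hence Jpos: "0 < J" using J_ge0 by simp
    \<comment> \<open>\<open>C\<close> bounds the squared distance between any two points of
      \<open>S\<close> and is at least \<open>J\<close>. The step \<open>t = J / C\<close> lies in
      [0, 1] and minimizes \<open>- 2 * t * J + t\<^sup>2 * C\<close>, with value
      \<open>- J\<^sup>2 / C\<close>; therefore \<open>u\<close> is chosen within
      \<open>J\<^sup>2 / C\<close> of the infimum.\<close>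
    define C where "C = real (card I) * (2 * M)\<^sup>2 + J + 1"
    have Cpos: "0 < C" and JC: "J \<le> C" using Jpos by (auto simp: C_def intro: add_nonneg_pos)
    define t where "t = J / C"
    have t: "0 \<le> t" "t \<le> 1" "0 < t" using Cpos JC Jpos by (auto simp: t_def)
    obtain u where u: "u \<in> S" "\<Phi> u < J + J\<^sup>2 / C"
      using J_near[of "J\<^sup>2 / C"] Jpos Cpos by auto
    define y where "y i = max 0 (b i - u i)" for i
    obtain u' where u': "u' \<in> S" "(\<Sum>i\<in>I. y i * b i) \<le> (\<Sum>i\<in>I. y i * u' i)"
      using resp[of y] by (auto simp: y_def)
    obtain z where z: "z \<in> S" "\<And>i. i \<in> I \<Longrightarrow> z i = u i + t * (u' i - u i)"
      using conv[OF u(1) u'(1) t(1,2)] by blast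
    define d where "d i = u' i - u i" for i
    have "\<bar>d i\<bar> \<le> \<bar>2 * M\<bar>" if "i \<in> I" for i
      using bdd[OF u(1) that] bdd[OF u'(1) that] unfolding d_def by linarith
    hence "(\<Sum>i\<in>I. (d i)\<^sup>2) \<le> (\<Sum>i\<in>I. (2 * M)\<^sup>2)"
      by (intro sum_mono) (simp only: abs_le_square_iff)
    hence dC: "(\<Sum>i\<in>I. (d i)\<^sup>2) \<le> C" using J_ge0 by (simp add: C_def)
    have y2: "y i * (b i - u i) = (y i)\<^sup>2" for i by (auto simp: y_def max_def power2_eq_square)
    have "\<Phi> u = (\<Sum>i\<in>I. y i * (b i - u i))" by (simp only: y2) (simp add: \<Phi>_def y_def)
    also have "\<dots> \<le> (\<Sum>i\<in>I. y i * d i)"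
      using u'(2) by (simp add: d_def algebra_simps sum_subtractf)
    finally have yd: "\<Phi> u \<le> (\<Sum>i\<in>I. y i * d i)" .
    have "\<Phi> z \<le> (\<Sum>i\<in>I. (y i - t * d i)\<^sup>2)"
      unfolding \<Phi>_def
    proof (rule sum_mono)
      fix i assume "i \<in> I"
      \<comment> \<open>The new deficit \<open>b i - z i\<close> equals
        \<open>b i - u i - t * d i\<close>, which is at most \<open>y i - t * d i\<close>.\<close>
      have "\<bar>max 0 (b i - z i)\<bar> \<le> \<bar>y i - t * d i\<bar>"
        using z(2)[OF \<open>i \<in> I\<close>] by (auto simp: y_def d_def)
      thus "(max 0 (b i - z i))\<^sup>2 \<le> (y i - t * d i)\<^sup>2" by (simp only: abs_le_square_iff)
    qed
    also have "\<dots> = \<Phi> u - 2 * t * (\<Sum>i\<in>I. y i * d i) + t\<^sup>2 * (\<Sum>i\<in>I. (d i)\<^sup>2)"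
      by (simp add: \<Phi>_def y_def power2_diff sum.distrib sum_subtractf sum_distrib_left
          power_mult_distrib mult.assoc mult.left_commute)
    also have "\<dots> \<le> \<Phi> u - 2 * t * J + t\<^sup>2 * C"
      using yd J_le[OF u(1)] dC t by (intro add_mono diff_mono mult_left_mono) auto
    also have "\<dots> = \<Phi> u - J\<^sup>2 / C"
      using Cpos by (simp add: t_def field_simps power2_eq_square)
    also have "\<dots> < J" using u(2) by simp
    finally show False using J_le[OF z(1)] by simp
  qed
  then obtain u where u: "u \<in> S" "\<Phi> u < \<epsilon>\<^sup>2" using J_near[of "\<epsilon>\<^sup>2"] eps by auto
  have "b i - \<epsilon> \<le> u i" if "i \<in> I" for i
  proof -
    have "(max 0 (b i - u i))\<^sup>2 \<le> \<Phi> u"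
      unfolding \<Phi>_def using fin that by (intro member_le_sum) auto
    hence "(max 0 (b i - u i))\<^sup>2 < \<epsilon>\<^sup>2" using u(2) by simp
    hence "max 0 (b i - u i) < \<epsilon>" using eps by (meson power_less_imp_less_base less_imp_le)
    thus ?thesis by simp
  qed
  with u(1) show ?thesis by blast
qed

text \<open>Bounding one factor of each product shows that \<open>X k\<close> is at most both
  \<open>p k * B k\<close> and \<open>A k * \<beta>\<close>, hence at most their geometric mean. The
  inequality of arithmetic and geometric means replaces it by terms linear in \<open>p k\<close> and
  in \<open>A k * B k\<close>. The sum of \<open>A k * B k\<close> over \<open>k\<close> consists of
  \<open>card I\<close> sums of the kind bounded by \<open>cross\<close>.\<close>

lemma sum_product_bound:
  fixes a b :: "'i \<Rightarrow> 'k \<Rightarrow> real" and p :: "'k \<Rightarrow> real"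
  assumes fin: "finite I"
    and a: "\<And>i k. i \<in> I \<Longrightarrow> k \<in> K \<Longrightarrow> 0 \<le> a i k \<and> a i k \<le> p k"
    and b: "\<And>i k. i \<in> I \<Longrightarrow> k \<in> K \<Longrightarrow> 0 \<le> b i k \<and> b i k \<le> \<beta>"
    and p: "\<And>k. k \<in> K \<Longrightarrow> 0 \<le> p k"
    and cross: "\<And>i. i \<in> I \<Longrightarrow> (\<Sum>j\<in>I. \<Sum>k\<in>K. a j k * b i k) \<le> (\<Sum>k\<in>K. p k)"
    and ne: "I \<noteq> {}" and beta: "0 \<le> \<beta>"
  shows "(\<Sum>i\<in>I. \<Sum>k\<in>K. a i k * b i k) \<le> sqrt (real (card I) * \<beta>) * (\<Sum>k\<in>K. p k)"
proof -
  define N where "N = real (card I)"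
  \<comment> \<open>With this weight, each of the two linear terms contributes at most
    \<open>s * P\<close> after summation.\<close>
  define s where "s = sqrt (N * \<beta>)"
  define P where "P = (\<Sum>k\<in>K. p k)"
  have N: "0 < N" using fin ne by (simp add: N_def card_gt_0_iff)
  have s: "0 \<le> s" "s\<^sup>2 = N * \<beta>" using N beta by (auto simp: s_def)
  define X where "X k = (\<Sum>i\<in>I. a i k * b i k)" for k
  define A where "A k = (\<Sum>i\<in>I. a i k)" for k
  define B where "B k = (\<Sum>i\<in>I. b i k)" for k
  have four_mult_le: "4 * (x * y) \<le> (x + y)\<^sup>2" for x y :: real
    using zero_le_power2[of "x - y"] by (simp add: power2_sum power2_diff)
  have "2 * X k \<le> s * p k + s / N * (A k * B k)" if k: "k \<in> K" for k
  proof -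
    have X0: "0 \<le> X k" "0 \<le> A k" "0 \<le> B k"
      unfolding X_def A_def B_def using a b k by (auto intro!: sum_nonneg)
    have "X k \<le> p k * B k" unfolding X_def B_def sum_distrib_left
      using a b k by (intro sum_mono mult_right_mono) auto
    moreover have "X k \<le> A k * \<beta>" unfolding X_def A_def sum_distrib_right
      using a b k by (intro sum_mono mult_left_mono) auto
    ultimately have "X k * X k \<le> (p k * B k) * (A k * \<beta>)"
      using X0 by (intro mult_mono) auto
    also have "\<dots> = (s * p k) * (s / N * (A k * B k))"
      using s(2) N by (simp add: power2_eq_square field_simps)
    finally have "(2 * X k)\<^sup>2 \<le> 4 * ((s * p k) * (s / N * (A k * B k)))"
      by (simp add: power2_eq_square)
    also have "\<dots> \<le> (s * p k + s / N * (A k * B k))\<^sup>2"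
      by (rule four_mult_le)
    finally show ?thesis
      by (rule power2_le_imp_le) (use s X0 N p[OF k] in auto)
  qed
  hence "(\<Sum>k\<in>K. 2 * X k) \<le> (\<Sum>k\<in>K. s * p k + s / N * (A k * B k))" by (rule sum_mono)
  also have "\<dots> = s * P + s / N * (\<Sum>k\<in>K. A k * B k)"
    by (simp add: P_def sum.distrib sum_distrib_left)
  also have "(\<Sum>k\<in>K. A k * B k) = (\<Sum>i\<in>I. \<Sum>j\<in>I. \<Sum>k\<in>K. a j k * b i k)"
  proof -
    have "(\<Sum>k\<in>K. A k * B k) = (\<Sum>k\<in>K. \<Sum>i\<in>I. \<Sum>j\<in>I. a j k * b i k)"
      unfolding A_def B_def sum_product by (intro sum.cong refl sum.swap)
    also have "\<dots> = (\<Sum>i\<in>I. \<Sum>k\<in>K. \<Sum>j\<in>I. a j k * b i k)" by (rule sum.swap)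
    also have "\<dots> = (\<Sum>i\<in>I. \<Sum>j\<in>I. \<Sum>k\<in>K. a j k * b i k)"
      by (intro sum.cong refl sum.swap)
    finally show ?thesis .
  qed
  also have "s * P + s / N * \<dots> \<le> s * P + s / N * (N * P)"
    using sum_bounded_above[of I "\<lambda>i. \<Sum>j\<in>I. \<Sum>k\<in>K. a j k * b i k" P] cross s N
    by (intro add_left_mono mult_left_mono) (auto simp: P_def N_def)
  also have "\<dots> = 2 * (s * P)" using N by simp
  finally have "(\<Sum>k\<in>K. X k) \<le> s * P" by (simp flip: sum_distrib_left)
  moreover have "(\<Sum>i\<in>I. \<Sum>k\<in>K. a i k * b i k) = (\<Sum>k\<in>K. X k)"
    unfolding X_def by (rule sum.swap)
  ultimately show ?thesis by (simp add: s_def P_def N_def)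
qed

section \<open>Upper bound for arbitrary chosen sets of unknown agents\<close>

text \<open>Up to a factor 2, \<open>i\<close> together with its unknown agents number
  \<open>n / \<Delta>\<close>. The rounding and the \<open>- 1\<close> are absorbed by
  \<open>1 \<le> \<Delta> * (card W + 1)\<close> on one side and by \<open>\<Delta> \<le> n\<close>
  on the other.\<close>

lemma unknown_sets_card_bounds:
  assumes "W \<in> unknown_sets n \<Delta> i" "1 \<le> n" "1 \<le> \<Delta>" "\<Delta> \<le> real n"
  shows "real n \<le> 2 * \<Delta> * (real (card W) + 1)" "\<Delta> * (real (card W) + 1) \<le> 2 * real n"
proof -
  have "int (card W) = \<lfloor>(real n - 1) / \<Delta>\<rfloor>" using assms by (auto simp: unknown_sets_def)
  hence "real (card W) \<le> (real n - 1) / \<Delta>" "(real n - 1) / \<Delta> < real (card W) + 1"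
    by linarith+
  hence "real (card W) * \<Delta> \<le> real n - 1" "real n - 1 < (real (card W) + 1) * \<Delta>"
    using assms by (auto simp: field_simps)
  moreover have "1 \<le> \<Delta> * (real (card W) + 1)"
    using assms mult_mono[of 1 \<Delta> 1 "real (card W) + 1"] by simp
  ultimately show "real n \<le> 2 * \<Delta> * (real (card W) + 1)"
      "\<Delta> * (real (card W) + 1) \<le> 2 * real n"
    using assms by (auto simp: algebra_simps)
qed

lemma EFS_feasible_bundle_le:
  assumes A: "A \<in> EFS_feasible n m v i W" and W: "W \<subseteq> {1..n} - {i}" and i: "i \<in> {1..n}"
    and k: "k \<in> {1..m}"
  shows "(real (card W) + 1) * A i k \<le> 1"
proof -
  have fW: "finite W" and iW: "i \<notin> W" using W finite_subset by auto
  have eq: "A j k = A i k" if "j \<in> W" for j using A that k by (auto simp: EFS_feasible_def)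
  have "(real (card W) + 1) * A i k = (\<Sum>j\<in>insert i W. A i k)"
    using fW iW by (simp add: algebra_simps)
  also have "\<dots> = (\<Sum>j\<in>insert i W. A j k)" using eq by (intro sum.cong) auto
  also have "\<dots> \<le> (\<Sum>j\<in>{1..n}. A j k)"
    using A W i k by (intro sum_mono2) (auto simp: EFS_feasible_def allocations_def is_bundle_def)
  also have "\<dots> \<le> 1" using A k by (auto simp: EFS_feasible_def allocations_def)
  finally show ?thesis .
qed

lemma EFS_feasible_no_envy:
  assumes A: "A \<in> EFS_feasible n m v i W" and j: "j \<in> {1..n}"
  shows "utility m v j (A i) \<le> utility m v j (A j)"
proof (cases "j \<in> W")
  case True
  hence "utility m v j (A i) = utility m v j (A j)"
    using A by (auto simp: utility_def EFS_feasible_def)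
  thus ?thesis by simp
next
  case False
  thus ?thesis using A j by (cases "j = i") (auto simp: EFS_feasible_def)
qed

text \<open>Item \<open>k\<close> is handed out in amounts of total at most 1, so it adds at most
  \<open>p k\<close>. The bound \<open>p\<close> is left free: the upper bound takes the largest
  weighted values, the lower bound takes unit weights.\<close>

lemma weighted_welfare_le:
  assumes A: "A \<in> allocations n m" and y: "\<And>i k. i \<in> {1..n} \<Longrightarrow> k \<in> {1..m} \<Longrightarrow> y i * v i k \<le> p k"
    and p: "\<And>k. k \<in> {1..m} \<Longrightarrow> 0 \<le> p k"
  shows "(\<Sum>i\<in>{1..n}. y i * utility m v i (A i)) \<le> (\<Sum>k\<in>{1..m}. p k)"
proof -
  have "(\<Sum>i\<in>{1..n}. y i * utility m v i (A i)) = (\<Sum>i\<in>{1..n}. \<Sum>k\<in>{1..m}. y i * v i k * A i k)"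
    by (simp add: utility_def sum_distrib_left mult.assoc)
  also have "\<dots> = (\<Sum>k\<in>{1..m}. \<Sum>i\<in>{1..n}. y i * v i k * A i k)" by (rule sum.swap)
  also have "\<dots> \<le> (\<Sum>k\<in>{1..m}. p k)"
  proof (rule sum_mono)
    fix k assume k: "k \<in> {1..m}"
    have "(\<Sum>i\<in>{1..n}. y i * v i k * A i k) \<le> (\<Sum>i\<in>{1..n}. p k * A i k)"
      using A y k by (intro sum_mono mult_right_mono) (auto simp: allocations_def is_bundle_def)
    also have "\<dots> = p k * (\<Sum>i\<in>{1..n}. A i k)" by (simp add: sum_distrib_left)
    also have "\<dots> \<le> p k * 1"
      using A p k by (intro mult_left_mono) (auto simp: allocations_def)
    finally show "(\<Sum>i\<in>{1..n}. y i * v i k * A i k) \<le> p k" by simp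
  qed
  finally show ?thesis .
qed

text \<open>Each item goes whole to an agent \<open>g k\<close> whose weighted value for it is
  largest. These allocations serve as the best responses in \<open>approachability\<close>.\<close>

lemma weighted_welfare_attained:
  assumes n: "1 \<le> n"
  obtains A where "A \<in> allocations n m"
    and "(\<Sum>i\<in>{1..n}. y i * utility m v i (A i)) = (\<Sum>k\<in>{1..m}. Max ((\<lambda>i. y i * v i k) ` {1..n}))"
proof -
  define p where "p k = Max ((\<lambda>i. y i * v i k) ` {1..n})" for k
  have "p k \<in> (\<lambda>i. y i * v i k) ` {1..n}" for k
    unfolding p_def using n by (intro Max_in) auto
  hence "\<forall>k. \<exists>i. i \<in> {1..n} \<and> p k = y i * v i k" by blast
  then obtain g where g: "\<And>k. g k \<in> {1..n}" "\<And>k. p k = y (g k) * v (g k) k" by metis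
  define A :: allocation where "A i k = (if i = g k then 1 else 0)" for i k
  have "A \<in> allocations n m"
    using g(1) by (auto simp: A_def allocations_def is_bundle_def)
  moreover have "(\<Sum>i\<in>{1..n}. y i * utility m v i (A i)) = (\<Sum>k\<in>{1..m}. p k)"
  proof -
    have "(\<Sum>i\<in>{1..n}. y i * utility m v i (A i)) = (\<Sum>i\<in>{1..n}. \<Sum>k\<in>{1..m}. y i * v i k * A i k)"
      by (simp add: utility_def sum_distrib_left mult.assoc)
    also have "\<dots> = (\<Sum>k\<in>{1..m}. \<Sum>i\<in>{1..n}. y i * v i k * A i k)" by (rule sum.swap)
    also have "\<dots> = (\<Sum>k\<in>{1..m}. p k)"
      using g by (intro sum.cong refl) (simp add: A_def if_distrib cong: if_cong)
    finally show ?thesis .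
  qed
  ultimately show ?thesis using that by (simp add: p_def)
qed

lemma weighted_EFS_le_welfare:
  assumes n: "1 \<le> n" and D: "1 \<le> \<Delta>" "\<Delta> \<le> real n" and v: "fair_instance n m v"
    and W: "\<And>i. i \<in> {1..n} \<Longrightarrow> W i \<in> unknown_sets n \<Delta> i"
    and y: "\<And>i. i \<in> {1..n} \<Longrightarrow> 0 \<le> y i"
  shows "(\<Sum>i\<in>{1..n}. y i * EFS_given n m v i (W i))
    \<le> sqrt (2 * \<Delta>) * (\<Sum>k\<in>{1..m}. Max ((\<lambda>i. y i * v i k) ` {1..n}))"
proof -
  define p where "p k = Max ((\<lambda>i. y i * v i k) ` {1..n})" for k
  have Wsub: "W i \<subseteq> {1..n} - {i}" if "i \<in> {1..n}" for i
    using W[OF that] by (auto simp: unknown_sets_def)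
  have "\<forall>i\<in>{1..n}. \<exists>A\<in>EFS_feasible n m v i (W i). utility m v i (A i) = EFS_given n m v i (W i)"
    using EFS_given_is_max Wsub by (metis Diff_subset subset_trans)
  \<comment> \<open>\<open>A i\<close> is a whole allocation, a separate one for each agent; only
    the bundle \<open>A i i\<close> of agent \<open>i\<close> in it enters the product sums.\<close>
  then obtain A where A: "\<And>i. i \<in> {1..n} \<Longrightarrow> A i \<in> EFS_feasible n m v i (W i)"
    and opt: "\<And>i. i \<in> {1..n} \<Longrightarrow> utility m v i (A i i) = EFS_given n m v i (W i)"
    by metis
  have alloc: "A i \<in> allocations n m" if "i \<in> {1..n}" for i
    using A[OF that] by (simp add: EFS_feasible_def)
  have a: "0 \<le> y i * v i k \<and> y i * v i k \<le> p k" if "i \<in> {1..n}" "k \<in> {1..m}" for i k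
    using v y that by (auto simp: p_def fair_instance_def)
  have p: "0 \<le> p k" if "k \<in> {1..m}" for k
    using a[of 1 k] n that by auto
  have b: "0 \<le> A i i k \<and> A i i k \<le> 2 * \<Delta> / n" if i: "i \<in> {1..n}" and k: "k \<in> {1..m}" for i k
  proof -
    have 0: "0 \<le> A i i k" using alloc[OF i] i k by (auto simp: allocations_def is_bundle_def)
    have "real n * A i i k \<le> 2 * \<Delta> * (real (card (W i)) + 1) * A i i k"
      using unknown_sets_card_bounds(1)[OF W[OF i] n D] 0 by (rule mult_right_mono)
    also have "\<dots> \<le> 2 * \<Delta> * 1"
      using EFS_feasible_bundle_le[OF A[OF i] Wsub[OF i] i k] D
      unfolding mult.assoc by (intro mult_left_mono) auto
    finally show ?thesis using 0 n by (simp add: field_simps)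
  qed
  have cross: "(\<Sum>j\<in>{1..n}. \<Sum>k\<in>{1..m}. y j * v j k * A i i k) \<le> (\<Sum>k\<in>{1..m}. p k)"
    if i: "i \<in> {1..n}" for i
  proof -
    have "(\<Sum>j\<in>{1..n}. \<Sum>k\<in>{1..m}. y j * v j k * A i i k)
        = (\<Sum>j\<in>{1..n}. y j * utility m v j (A i i))"
      by (simp add: utility_def sum_distrib_left mult.assoc)
    also have "\<dots> \<le> (\<Sum>j\<in>{1..n}. y j * utility m v j (A i j))"
      using y EFS_feasible_no_envy[OF A[OF i]] by (intro sum_mono mult_left_mono) auto
    also have "\<dots> \<le> (\<Sum>k\<in>{1..m}. p k)"
      using a p by (intro weighted_welfare_le[OF alloc[OF i]]) auto
    finally show ?thesis .
  qed
  have "(\<Sum>i\<in>{1..n}. y i * EFS_given n m v i (W i))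
      = (\<Sum>i\<in>{1..n}. \<Sum>k\<in>{1..m}. y i * v i k * A i i k)"
    by (intro sum.cong refl) (simp add: opt[symmetric] utility_def sum_distrib_left mult.assoc)
  \<comment> \<open>Here \<open>\<beta> = 2 * \<Delta> / n\<close>, so that
    \<open>card I * \<beta>\<close> becomes \<open>2 * \<Delta>\<close>, free of
    \<open>n\<close>.\<close>
  also have "\<dots> \<le> sqrt (real (card {1..n}) * (2 * \<Delta> / n)) * (\<Sum>k\<in>{1..m}. p k)"
    using a b p cross n D by (intro sum_product_bound) auto
  finally show ?thesis using n by (simp add: p_def)
qed

lemma EFS_given_nonneg:
  assumes "i \<in> {1..n}" "W \<subseteq> {1..n}"
  shows "0 \<le> EFS_given n m v i W"
proof -
  have "utility m v i ((\<lambda>_ _. 0) i) \<le> EFS_given n m v i W"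
    using EFS_given_is_max[OF assms, of m v] zero_EFS_feasible[of n m v i W] by metis
  thus ?thesis by (simp add: utility_def)
qed

text \<open>The inequality \<open>weighted_EFS_le_welfare\<close> supplies the responses that
  \<open>approachability\<close> asks for, with targets \<open>\<theta> * E i\<close>. The resulting
  error \<open>\<epsilon>\<close> is absorbed by the gap between \<open>\<theta>\<close> and the
  smaller factor \<open>\<theta>'\<close>.\<close>

lemma EFS_given_approximable:
  assumes n: "1 \<le> n" and D: "1 \<le> \<Delta>" "\<Delta> \<le> real n" and v: "fair_instance n m v"
    and W: "\<And>i. i \<in> {1..n} \<Longrightarrow> W i \<in> unknown_sets n \<Delta> i"
  shows "\<exists>A\<in>allocations n m. \<forall>i\<in>{1..n}.
           1 / (3 * sqrt \<Delta>) * EFS_given n m v i (W i) \<le> utility m v i (A i)"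
proof -
  define E where "E i = EFS_given n m v i (W i)" for i
  define \<theta> where "\<theta> = 1 / sqrt (2 * \<Delta>)"
  define \<theta>' where "\<theta>' = 1 / (3 * sqrt \<Delta>)"
  have th: "0 < \<theta>'" "\<theta>' < \<theta>"
  proof -
    have "sqrt 2 < (3::real)" by (rule real_less_lsqrt) auto
    thus "0 < \<theta>'" "\<theta>' < \<theta>"
      using D by (auto simp: \<theta>_def \<theta>'_def real_sqrt_mult intro!: divide_strict_left_mono)
  qed
  have E0: "0 \<le> E i" if "i \<in> {1..n}" for i
    unfolding E_def by (rule EFS_given_nonneg[OF that]) (use W[OF that] in \<open>auto simp: unknown_sets_def\<close>)
  \<comment> \<open>Small enough for every agent with a positive share; agents with share 0 are
    satisfied by any allocation. The element 1 keeps the set nonempty.\<close>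
  define \<epsilon> where "\<epsilon> = Min (insert 1 ((\<lambda>i. (\<theta> - \<theta>') * E i) ` {i\<in>{1..n}. 0 < E i}))"
  have eps: "0 < \<epsilon>" unfolding \<epsilon>_def using th by (subst Min_gr_iff) auto
  have eps_le: "\<epsilon> \<le> (\<theta> - \<theta>') * E i" if "i \<in> {1..n}" "0 < E i" for i
    unfolding \<epsilon>_def using that by (intro Min_le) auto
  define S where "S = (\<lambda>A i. utility m v i (A i)) ` allocations n m"
  define M where "M = (\<Sum>i\<in>{1..n}. \<Sum>k\<in>{1..m}. v i k)"
  have v0: "0 \<le> v i k" if "i \<in> {1..n}" "k \<in> {1..m}" for i k
    using v that by (auto simp: fair_instance_def)
  have "\<exists>u\<in>S. \<forall>i\<in>{1..n}. \<theta> * E i - \<epsilon> \<le> u i"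
  proof (rule approachability[where M = M])
    fix u u' and t :: real assume "u \<in> S" "u' \<in> S" and t: "0 \<le> t" "t \<le> 1"
    then obtain A A' where A: "A \<in> allocations n m" "A' \<in> allocations n m"
      and u: "u = (\<lambda>i. utility m v i (A i))" "u' = (\<lambda>i. utility m v i (A' i))"
      by (auto simp: S_def)
    define Z :: allocation where "Z i k = (1 - t) * A i k + t * A' i k" for i k
    have "Z \<in> allocations n m"
      unfolding allocations_def is_bundle_def
    proof safe
      fix i k assume ik: "i \<in> {1..n}" "k \<in> {1..m}"
      show "0 \<le> Z i k" using A ik t by (auto simp: Z_def allocations_def is_bundle_def)
      show "Z i k \<le> 1" unfolding Z_def
        using A ik t by (intro convex_bound_le) (auto simp: allocations_def is_bundle_def)
    next
      fix k assume k: "k \<in> {1..m}"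
      have "(\<Sum>i\<in>{1..n}. Z i k) = (1 - t) * (\<Sum>i\<in>{1..n}. A i k) + t * (\<Sum>i\<in>{1..n}. A' i k)"
        by (simp add: Z_def sum.distrib sum_distrib_left)
      also have "\<dots> \<le> 1"
        using A k t by (intro convex_bound_le) (auto simp: allocations_def)
      finally show "(\<Sum>i\<in>{1..n}. Z i k) \<le> 1" .
    qed
    moreover have "utility m v i (Z i) = u i + t * (u' i - u i)" for i
    proof -
      have "utility m v i (Z i) = (1 - t) * u i + t * u' i"
        by (simp add: u utility_def Z_def distrib_left sum.distrib sum_distrib_left mult.left_commute)
      thus ?thesis by (simp add: algebra_simps)
    qed
    ultimately show "\<exists>z\<in>S. \<forall>i\<in>{1..n}. z i = u i + t * (u' i - u i)"
      unfolding S_def by (intro bexI[OF _ imageI[where x = Z]]) auto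
  next
    fix u i assume "u \<in> S" and i: "i \<in> {1..n}"
    then obtain A where A: "A \<in> allocations n m" and u: "u i = utility m v i (A i)"
      by (auto simp: S_def)
    have A01: "0 \<le> A i k \<and> A i k \<le> 1" if "k \<in> {1..m}" for k
      using A i that by (auto simp: allocations_def is_bundle_def)
    have "0 \<le> u i" unfolding u utility_def using A01 v0 i by (auto intro!: sum_nonneg)
    moreover have "u i \<le> (\<Sum>k\<in>{1..m}. v i k)"
      unfolding u utility_def using A01 v0 i by (intro sum_mono mult_left_le) auto
    moreover have "\<dots> \<le> M"
      unfolding M_def using i v0
      by (intro member_le_sum[where f = "\<lambda>i. \<Sum>k\<in>{1..m}. v i k"] sum_nonneg) auto
    ultimately show "\<bar>u i\<bar> \<le> M" by simp
  next
    fix y :: "nat \<Rightarrow> real" assume y: "\<And>i. i \<in> {1..n} \<Longrightarrow> 0 \<le> y i"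
    obtain A where A: "A \<in> allocations n m"
      "(\<Sum>i\<in>{1..n}. y i * utility m v i (A i)) = (\<Sum>k\<in>{1..m}. Max ((\<lambda>i. y i * v i k) ` {1..n}))"
      using weighted_welfare_attained[OF n] .
    have "(\<Sum>i\<in>{1..n}. y i * E i) \<le> sqrt (2 * \<Delta>) * (\<Sum>i\<in>{1..n}. y i * utility m v i (A i))"
      unfolding A(2) E_def using weighted_EFS_le_welfare[OF n D v W y] .
    hence "\<theta> * (\<Sum>i\<in>{1..n}. y i * E i) \<le> (\<Sum>i\<in>{1..n}. y i * utility m v i (A i))"
      using D by (simp add: \<theta>_def field_simps)
    thus "\<exists>u\<in>S. (\<Sum>i\<in>{1..n}. y i * (\<theta> * E i)) \<le> (\<Sum>i\<in>{1..n}. y i * u i)"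
      using A(1) by (auto simp: S_def sum_distrib_left mult.left_commute)
  qed (use eps in auto)
  then obtain A where A: "A \<in> allocations n m"
    and near: "\<And>i. i \<in> {1..n} \<Longrightarrow> \<theta> * E i - \<epsilon> \<le> utility m v i (A i)"
    by (auto simp: S_def)
  have "\<theta>' * E i \<le> utility m v i (A i)" if i: "i \<in> {1..n}" for i
  proof (cases "0 < E i")
    case True
    thus ?thesis using near[OF i] eps_le[OF i True] by (simp add: algebra_simps)
  next
    case False
    hence "E i = 0" using E0[OF i] by simp
    moreover have "0 \<le> utility m v i (A i)"
      unfolding utility_def using A v0 i
      by (auto simp: allocations_def is_bundle_def intro!: sum_nonneg)
    ultimately show ?thesis by simp
  qed
  with A show ?thesis unfolding \<theta>'_def E_def by blast
qed

section \<open>From fixed sets to the expected share\<close>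

lemma EFS_eq_average:
  assumes "i \<in> {1..n}" "1 \<le> \<Delta>"
  shows "EFS \<Delta> n m v i =
    (\<Sum>W\<in>unknown_sets n \<Delta> i. EFS_given n m v i W) / real (card (unknown_sets n \<Delta> i))"
  unfolding EFS_def
  using unknown_sets_nonempty[OF assms] unknown_sets_finite by (rule integral_pmf_of_set)

text \<open>An average cannot exceed all of its terms. Choosing such a set for every agent reduces
  the expected share to the case of chosen sets.\<close>

lemma EFS_le_some_EFS_given:
  assumes "i \<in> {1..n}" "1 \<le> \<Delta>"
  shows "\<exists>W\<in>unknown_sets n \<Delta> i. EFS \<Delta> n m v i \<le> EFS_given n m v i W"
proof (rule ccontr)
  let ?U = "unknown_sets n \<Delta> i"
  assume "\<not> ?thesis"
  hence "(\<Sum>W\<in>?U. EFS_given n m v i W) < (\<Sum>W\<in>?U. EFS \<Delta> n m v i)"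
    using unknown_sets_finite unknown_sets_nonempty[OF assms] by (intro sum_strict_mono) auto
  moreover have "0 < card ?U"
    using unknown_sets_finite unknown_sets_nonempty[OF assms] by (simp add: card_gt_0_iff)
  ultimately show False using EFS_eq_average[OF assms, of m v] by (simp add: field_simps)
qed

lemma EFS_ge:
  assumes "i \<in> {1..n}" "1 \<le> \<Delta>" and "\<And>W. W \<in> unknown_sets n \<Delta> i \<Longrightarrow> c \<le> EFS_given n m v i W"
  shows "c \<le> EFS \<Delta> n m v i"
proof -
  let ?U = "unknown_sets n \<Delta> i"
  have "0 < card ?U"
    using unknown_sets_finite unknown_sets_nonempty[OF assms(1,2)] by (simp add: card_gt_0_iff)
  moreover have "real (card ?U) * c \<le> (\<Sum>W\<in>?U. EFS_given n m v i W)"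
    using sum_mono[of ?U "\<lambda>_. c"] assms(3) by simp
  ultimately show ?thesis
    unfolding EFS_eq_average[OF assms(1,2)] by (simp add: field_simps)
qed

section \<open>The lower bound instance\<close>

text \<open>
  The agents are split into \<open>q \<approx> \<surd>\<Delta>\<close> groups by residue. Every group has an item of its own, and
  item \<open>q + 1\<close> is worth enough to compensate any single group, but not all of them.
\<close>

definition group_valuation :: "nat \<Rightarrow> nat \<Rightarrow> nat \<Rightarrow> valuations" where
  "group_valuation n q w i k =
     (if k = Suc q then real (n div q) + 1 else if k = Suc (i mod q) then real w + 1 else 0)"

text \<open>Within a residue class, \<open>j\<close> is determined by \<open>j div q\<close>, which
  lies between 0 and \<open>n div q\<close>.\<close>

lemma card_residue_class_le:
  assumes "0 < q"
  shows "card {j\<in>{1..n}. j mod q = r} \<le> n div q + 1"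
proof -
  have "inj_on (\<lambda>j. j div q) {j\<in>{1..n}. j mod q = r}"
    by (rule inj_onI) (metis (mono_tags, lifting) div_mult_mod_eq mem_Collect_eq)
  hence "card {j\<in>{1..n}. j mod q = r} \<le> card {..n div q}"
    by (rule card_inj_on_le) (auto intro: div_le_mono)
  thus ?thesis by simp
qed

lemma utility_group_valuation:
  assumes "0 < q"
  shows "utility (Suc q) (group_valuation n q w) i B =
    (real (n div q) + 1) * B (Suc q) + (real w + 1) * B (Suc (i mod q))"
proof -
  \<comment> \<open>Residues stay below \<open>q\<close>, so no group item coincides with the common
    item \<open>Suc q\<close>.\<close>
  have i: "i mod q < q" using assms by simp
  have "utility (Suc q) (group_valuation n q w) i B =
      (\<Sum>k\<in>{1..Suc q}. (if k = Suc q then (real (n div q) + 1) * B (Suc q) else 0)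
        + (if k = Suc (i mod q) then (real w + 1) * B (Suc (i mod q)) else 0))"
    unfolding utility_def group_valuation_def using i by (intro sum.cong) auto
  also have "\<dots> = (real (n div q) + 1) * B (Suc q) + (real w + 1) * B (Suc (i mod q))"
    using i unfolding sum.distrib by simp
  finally show ?thesis .
qed

lemma EFS_given_group_valuation:
  assumes q: "0 < q" and i: "i \<in> {1..n}" and W: "W \<subseteq> {1..n} - {i}" "card W = w"
  shows "1 \<le> EFS_given n (Suc q) (group_valuation n q w) i W"
proof -
  let ?v = "group_valuation n q w"
  define T where "T = real (n div q) + 1"
  define V where "V = insert i W"
  define R where "R = {j\<in>{1..n}. j mod q = i mod q}"
  have T: "1 \<le> T" by (simp add: T_def)
  have V: "V \<subseteq> {1..n}" "finite V" "card V = w + 1" "i \<in> V"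
    using W i finite_subset[OF W(1)] by (auto simp: V_def card_insert_if)
  \<comment> \<open>Agent \<open>i\<close> and the unknown agents, whichever groups these belong to,
    split the item of the group of \<open>i\<close> evenly; each part is worth 1 to this group and 0
    to all others. The rest of the group, at most \<open>T\<close> agents, get \<open>1 / T\<close>
    of the common item each, also worth 1, so they do not envy \<open>i\<close>.\<close>
  define A :: allocation where "A j k =
      (if k = Suc (i mod q) then (if j \<in> V then 1 / (real w + 1) else 0)
       else if k = Suc q then (if j \<in> R - V then 1 / T else 0) else 0)" for j k
  have neq: "Suc (i mod q) \<noteq> Suc q" using q by (metis mod_less_divisor nat_neq_iff nat.inject)
  have ut: "utility (Suc q) ?v j (A l) =
      (if l \<in> R - V then 1 else 0) + (if j mod q = i mod q \<and> l \<in> V then 1 else 0)" for j l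
  proof -
    have "j mod q \<noteq> q" using q by (metis mod_less_divisor nat_neq_iff)
    thus ?thesis unfolding utility_group_valuation[OF q] T_def[symmetric]
      using neq T by (auto simp: A_def)
  qed
  have "A \<in> allocations n (Suc q)"
    unfolding allocations_def is_bundle_def
  proof safe
    fix j k
    show "0 \<le> A j k" "A j k \<le> 1" using T by (auto simp: A_def)
  next
    fix k
    consider "k = Suc (i mod q)" | "k = Suc q" "k \<noteq> Suc (i mod q)"
      | "k \<noteq> Suc q" "k \<noteq> Suc (i mod q)" by blast
    thus "(\<Sum>j\<in>{1..n}. A j k) \<le> 1"
    proof cases
      case 1
      have "(\<Sum>j\<in>{1..n}. A j k) = (\<Sum>j\<in>{1..n} \<inter> V. 1 / (real w + 1))"
        by (subst sum.inter_restrict) (simp_all add: A_def 1)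
      also have "{1..n} \<inter> V = V" using V by auto
      finally show ?thesis using V by simp
    next
      case 2
      have "(\<Sum>j\<in>{1..n}. A j k) = (\<Sum>j\<in>{1..n} \<inter> (R - V). 1 / T)"
        using 2 neq by (subst sum.inter_restrict) (simp_all add: A_def)
      also have "\<dots> = real (card ({1..n} \<inter> (R - V))) / T" by simp
      also have "card ({1..n} \<inter> (R - V)) \<le> card R"
        by (intro card_mono) (auto simp: R_def)
      hence "real (card ({1..n} \<inter> (R - V))) / T \<le> real (n div q + 1) / T"
        using card_residue_class_le[OF q, of n "i mod q"] T
        by (intro divide_right_mono) (auto simp: R_def)
      also have "\<dots> = 1" using T by (simp add: T_def)
      finally show ?thesis by simp
    next
      case 3
      thus ?thesis by (simp add: A_def)
    qed
  qed
  moreover have "utility (Suc q) ?v j (A i) \<le> utility (Suc q) ?v j (A j)"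
    if "j \<in> {1..n} - (W \<union> {i})" for j
    unfolding ut using that V(4) by (auto simp: R_def V_def)
  moreover have "A j k = A i k" if "j \<in> W" for j k
    using that V by (auto simp: A_def V_def)
  ultimately have "A \<in> EFS_feasible n (Suc q) ?v i W"
    unfolding EFS_feasible_def by blast
  hence "utility (Suc q) ?v i (A i) \<le> EFS_given n (Suc q) ?v i W"
    using EFS_given_is_max[OF i, of W "Suc q" ?v] W(1) by (metis Diff_subset subset_trans)
  thus ?thesis unfolding ut using V(4) by simp
qed

text \<open>The guarantees add up to \<open>n / \<alpha>\<close>, while the welfare is at most the
  value of the common item, counted once, plus that of the \<open>q\<close> group items.\<close>

lemma group_valuation_ratio_ge:
  assumes q: "0 < q" and n: "1 \<le> n" and al: "0 < \<alpha>" and A: "A \<in> allocations n (Suc q)"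
    and u: "\<And>i. i \<in> {1..n} \<Longrightarrow> 1 / \<alpha> \<le> utility (Suc q) (group_valuation n q w) i (A i)"
  shows "real n \<le> \<alpha> * (real (n div q) + 1 + real q * (real w + 1))"
proof -
  define p where "p k = (if k = Suc q then real (n div q) + 1 else real w + 1)" for k
  have "real n * (1 / \<alpha>) \<le> (\<Sum>i\<in>{1..n}. utility (Suc q) (group_valuation n q w) i (A i))"
    using sum_mono[of "{1..n}" "\<lambda>_. 1 / \<alpha>"] u by simp
  also have "\<dots> \<le> (\<Sum>k\<in>{1..Suc q}. p k)"
    using weighted_welfare_le[OF A, of "\<lambda>_. 1" "group_valuation n q w" p]
    by (simp add: p_def group_valuation_def)
  also have "\<dots> = real (n div q) + 1 + real q * (real w + 1)"
    by (simp add: p_def)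
  finally show ?thesis using al by (simp add: field_simps)
qed

text \<open>In the welfare bound, the common item contributes about \<open>n / q\<close> and the
  group items \<open>q * (w + 1)\<close>, of order \<open>q * n / \<Delta>\<close>; taking
  \<open>q\<close> as the integer part of \<open>sqrt \<Delta>\<close> balances them. The last
  property does not mention sets of unknown agents, so it serves both fixed sets and the expected
  share.\<close>

lemma group_instance_exists:
  assumes n: "1 \<le> n" and D: "1 \<le> \<Delta>" "\<Delta> \<le> real n"
  obtains m v where "1 \<le> m" "fair_instance n m v"
    and "\<And>i W. i \<in> {1..n} \<Longrightarrow> W \<in> unknown_sets n \<Delta> i \<Longrightarrow> 1 \<le> EFS_given n m v i W"
    and "\<And>\<alpha> A. 1 \<le> \<alpha> \<Longrightarrow> A \<in> allocations n m \<Longrightarrow>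
           (\<And>i. i \<in> {1..n} \<Longrightarrow> 1 / \<alpha> \<le> utility m v i (A i)) \<Longrightarrow> 1 / 6 * sqrt \<Delta> \<le> \<alpha>"
proof -
  define w where "w = nat \<lfloor>(real n - 1) / \<Delta>\<rfloor>"
  define s where "s = sqrt \<Delta>"
  define q where "q = nat \<lfloor>s\<rfloor>"
  have s: "1 \<le> s" "s * s = \<Delta>" using D by (auto simp: s_def)
  have q_eq: "real q = of_int \<lfloor>s\<rfloor>" using s(1) by (simp add: q_def)
  have "1 \<le> \<lfloor>s\<rfloor>" using s(1) by simp
  hence "1 \<le> real q" unfolding q_eq by linarith
  moreover have "real q \<le> s" "s < real q + 1" unfolding q_eq by linarith+
  ultimately have q: "1 \<le> q" "real q \<le> s" "s \<le> 2 * real q" by auto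
  have card_w: "card W = w" if "W \<in> unknown_sets n \<Delta> i" for W i
    using that unfolding w_def unknown_sets_def by (metis (mono_tags, lifting) mem_Collect_eq nat_int)
  \<comment> \<open>All sets of unknown agents have size \<open>w\<close>; \<open>W0\<close> merely
    transfers the cardinality bound to \<open>w\<close>.\<close>
  obtain W0 where W0: "W0 \<in> unknown_sets n \<Delta> 1"
    using unknown_sets_nonempty[of 1 n \<Delta>] n D by auto
  have sw: "s * s * (real w + 1) \<le> 2 * real n"
    using unknown_sets_card_bounds(2)[OF W0 n D] card_w[OF W0] s(2) by simp
  have "s \<le> s * s" using s(1) by simp
  hence qn: "real q \<le> real n" using q s D by linarith
  \<comment> \<open>The first summand gives \<open>4 * n\<close> by \<open>s \<le> 2 * q\<close> and
    \<open>q \<le> n\<close>, the second \<open>2 * n\<close> by \<open>q \<le> s\<close> and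
    \<open>sw\<close>. This is the origin of the constant 1/6.\<close>
  have bound: "s * (real (n div q) + 1 + real q * (real w + 1)) \<le> 6 * real n"
  proof -
    have "s * (real (n div q) + 1) \<le> 2 * real q * (real (n div q) + 1)"
      using q by (intro mult_right_mono) auto
    also have "\<dots> = 2 * real (n div q * q) + 2 * real q" by (simp add: algebra_simps)
    also have "\<dots> \<le> 4 * real n"
    proof -
      have "real (n div q * q) \<le> real n" by (simp only: of_nat_le_iff div_times_less_eq_dividend)
      thus ?thesis using qn by linarith
    qed
    finally have 1: "s * (real (n div q) + 1) \<le> 4 * real n" .
    have "s * (real q * (real w + 1)) \<le> s * (s * (real w + 1))"
      using q s by (intro mult_left_mono mult_right_mono) auto
    hence "s * (real q * (real w + 1)) \<le> 2 * real n" using sw by (simp add: mult.assoc)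
    with 1 show ?thesis by (simp add: distrib_left)
  qed
  show ?thesis
  proof (rule that[of "Suc q" "group_valuation n q w"])
    show "1 \<le> Suc q" by simp
    show "fair_instance n (Suc q) (group_valuation n q w)"
      by (auto simp: fair_instance_def group_valuation_def)
  next
    fix i W assume "i \<in> {1..n}" and W: "W \<in> unknown_sets n \<Delta> i"
    thus "1 \<le> EFS_given n (Suc q) (group_valuation n q w) i W"
      using card_w[OF W] q(1) by (intro EFS_given_group_valuation) (auto simp: unknown_sets_def)
  next
    fix \<alpha> :: real and A assume al: "1 \<le> \<alpha>" and A: "A \<in> allocations n (Suc q)"
      and u: "\<And>i. i \<in> {1..n} \<Longrightarrow> 1 / \<alpha> \<le> utility (Suc q) (group_valuation n q w) i (A i)"
    have "real n \<le> \<alpha> * (real (n div q) + 1 + real q * (real w + 1))"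
      by (rule group_valuation_ratio_ge[OF _ n _ A u]) (use q al in auto)
    hence "s * real n \<le> s * (\<alpha> * (real (n div q) + 1 + real q * (real w + 1)))"
      using s by (intro mult_left_mono) auto
    also have "\<dots> = \<alpha> * (s * (real (n div q) + 1 + real q * (real w + 1)))"
      by (simp only: mult.left_commute)
    also have "\<dots> \<le> \<alpha> * (6 * real n)"
      using bound al by (intro mult_left_mono) auto
    finally show "1 / 6 * sqrt \<Delta> \<le> \<alpha>" using n by (simp add: s_def[symmetric])
  qed
qed

section \<open>The worst-case ratio and the final statement\<close>

lemma worst_approx_ratio_EFS_le:
  assumes n: "1 \<le> n" and D: "1 \<le> \<Delta>" "\<Delta> \<le> real n"
  shows "worst_approx_ratio (EFS \<Delta>) n \<le> ereal (3 * sqrt \<Delta>)"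
  unfolding worst_approx_ratio_def
proof (rule SUP_least)
  fix m
  have sq: "1 \<le> sqrt \<Delta>" using D by simp
  hence sq3: "1 \<le> 3 * sqrt \<Delta>" by linarith
  have "\<exists>A\<in>allocations n m. \<forall>i\<in>{1..n}. EFS \<Delta> n m v i / (3 * sqrt \<Delta>) \<le> utility m v i (A i)"
    if v: "fair_instance n m v" for v
  proof -
    have "\<forall>i\<in>{1..n}. \<exists>W. W \<in> unknown_sets n \<Delta> i \<and> EFS \<Delta> n m v i \<le> EFS_given n m v i W"
      using EFS_le_some_EFS_given[OF _ D(1)] by blast
    then obtain W where W: "\<And>i. i \<in> {1..n} \<Longrightarrow> W i \<in> unknown_sets n \<Delta> i"
      and le: "\<And>i. i \<in> {1..n} \<Longrightarrow> EFS \<Delta> n m v i \<le> EFS_given n m v i (W i)"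
      unfolding bchoice_iff by blast
    obtain A where A: "A \<in> allocations n m"
      "\<And>i. i \<in> {1..n} \<Longrightarrow> 1 / (3 * sqrt \<Delta>) * EFS_given n m v i (W i) \<le> utility m v i (A i)"
      using EFS_given_approximable[OF n D v W] by blast
    have "EFS \<Delta> n m v i / (3 * sqrt \<Delta>) \<le> utility m v i (A i)" if "i \<in> {1..n}" for i
    proof -
      have "EFS \<Delta> n m v i / (3 * sqrt \<Delta>) \<le> EFS_given n m v i (W i) / (3 * sqrt \<Delta>)"
        using le[OF that] sq by (intro divide_right_mono) auto
      thus ?thesis using A(2)[OF that] by simp
    qed
    with A(1) show ?thesis by blast
  qed
  thus "approx_ratio (EFS \<Delta>) n m \<le> ereal (3 * sqrt \<Delta>)"
    unfolding approx_ratio_def using sq3 by (intro Inf_lower CollectI exI[of _ "3 * sqrt \<Delta>"]) blast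
qed

text \<open>In the group instance every set gives a share of at least 1, hence so does the
  expectation, and an allocation of ratio \<open>\<alpha>\<close> gives everyone at least
  \<open>1 / \<alpha>\<close>. Its number of items alone already bounds the supremum from
  below.\<close>

lemma worst_approx_ratio_EFS_ge:
  assumes n: "1 \<le> n" and D: "1 \<le> \<Delta>" "\<Delta> \<le> real n"
  shows "ereal (1 / 6 * sqrt \<Delta>) \<le> worst_approx_ratio (EFS \<Delta>) n"
proof -
  obtain m v where m: "1 \<le> m" and v: "fair_instance n m v"
    and E: "\<And>i W. i \<in> {1..n} \<Longrightarrow> W \<in> unknown_sets n \<Delta> i \<Longrightarrow> 1 \<le> EFS_given n m v i W"
    and low: "\<And>\<alpha> A. 1 \<le> \<alpha> \<Longrightarrow> A \<in> allocations n m \<Longrightarrow>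
      (\<And>i. i \<in> {1..n} \<Longrightarrow> 1 / \<alpha> \<le> utility m v i (A i)) \<Longrightarrow> 1 / 6 * sqrt \<Delta> \<le> \<alpha>"
    using group_instance_exists[OF n D] by blast
  have "ereal (1 / 6 * sqrt \<Delta>) \<le> approx_ratio (EFS \<Delta>) n m"
    unfolding approx_ratio_def
  proof (rule Inf_greatest, safe)
    fix \<alpha> :: real
    assume al: "1 \<le> \<alpha>" and "\<forall>v. fair_instance n m v \<longrightarrow>
      (\<exists>A\<in>allocations n m. \<forall>i\<in>{1..n}. utility m v i (A i) \<ge> EFS \<Delta> n m v i / \<alpha>)"
    then obtain A where A: "A \<in> allocations n m"
      "\<And>i. i \<in> {1..n} \<Longrightarrow> EFS \<Delta> n m v i / \<alpha> \<le> utility m v i (A i)"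
      using v by blast
    have "1 / \<alpha> \<le> utility m v i (A i)" if i: "i \<in> {1..n}" for i
    proof -
      have "1 / \<alpha> \<le> EFS \<Delta> n m v i / \<alpha>"
        using EFS_ge[OF i D(1) E[OF i]] al by (intro divide_right_mono) auto
      thus ?thesis using A(2)[OF i] by linarith
    qed
    thus "ereal (1 / 6 * sqrt \<Delta>) \<le> ereal \<alpha>" using low[OF al A(1)] by simp
  qed
  also have "\<dots> \<le> worst_approx_ratio (EFS \<Delta>) n"
    unfolding worst_approx_ratio_def using m by (intro SUP_upper) simp
  finally show ?thesis .
qed

theorem theorem4:
  shows "\<exists>K c :: real. 0 < K \<and> 0 < c \<and>
    (\<forall>(n::nat) (\<Delta>::real). 1 \<le> n \<and> 1 \<le> \<Delta> \<and> \<Delta> \<le> real n \<longrightarrow>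
      (ereal (c * sqrt \<Delta>) \<le> worst_approx_ratio (EFS \<Delta>) n \<and>
       worst_approx_ratio (EFS \<Delta>) n \<le> ereal (K * sqrt \<Delta>)) \<and>
      (\<forall>(m::nat) v W. 1 \<le> m \<and> fair_instance n m v \<and> (\<forall>i\<in>{1..n}. W i \<in> unknown_sets n \<Delta> i) \<longrightarrow>
        (\<exists>A\<in>allocations n m. \<forall>i\<in>{1..n}.
           utility m v i (A i) \<ge> 1 / (K * sqrt \<Delta>) * EFS_given n m v i (W i))) \<and>
      (\<exists>(m::nat) v. 1 \<le> m \<and> fair_instance n m v \<and>
        (\<forall>W. (\<forall>i\<in>{1..n}. W i \<in> unknown_sets n \<Delta> i) \<longrightarrow>
          (\<forall>(\<alpha>::real) A. 1 \<le> \<alpha> \<and> A \<in> allocations n m \<and>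
             (\<forall>i\<in>{1..n}. utility m v i (A i) \<ge> EFS_given n m v i (W i) / \<alpha>) \<longrightarrow>
             \<alpha> \<ge> c * sqrt \<Delta>))))"
\<comment> \<open>The value 3 for \<open>K\<close> is a convenient number above
  \<open>sqrt 2\<close>, the factor lost in the weighted inequality.\<close>
proof (rule exI[of _ 3], rule exI[of _ "1 / 6"], intro conjI allI impI; (elim conjE)?)
  show "0 < (3::real)" "0 < (1 / 6 :: real)" by simp_all
next
  fix n :: nat and \<Delta> :: real assume "1 \<le> n" "1 \<le> \<Delta>" "\<Delta> \<le> real n"
  thus "ereal (1 / 6 * sqrt \<Delta>) \<le> worst_approx_ratio (EFS \<Delta>) n"
    by (rule worst_approx_ratio_EFS_ge)
next
  fix n :: nat and \<Delta> :: real assume "1 \<le> n" "1 \<le> \<Delta>" "\<Delta> \<le> real n"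
  thus "worst_approx_ratio (EFS \<Delta>) n \<le> ereal (3 * sqrt \<Delta>)"
    by (rule worst_approx_ratio_EFS_le)
next
  fix n m :: nat and \<Delta> :: real and v W
  assume "1 \<le> n" "1 \<le> \<Delta>" "\<Delta> \<le> real n" "fair_instance n m v"
    "\<forall>i\<in>{1..n}. W i \<in> unknown_sets n \<Delta> i"
  thus "\<exists>A\<in>allocations n m. \<forall>i\<in>{1..n}.
      1 / (3 * sqrt \<Delta>) * EFS_given n m v i (W i) \<le> utility m v i (A i)"
    by (intro EFS_given_approximable) auto
next
  fix n :: nat and \<Delta> :: real assume n: "1 \<le> n" and D: "1 \<le> \<Delta>" "\<Delta> \<le> real n"
  obtain m v where m: "1 \<le> m" and v: "fair_instance n m v"
    and E: "\<And>i W. i \<in> {1..n} \<Longrightarrow> W \<in> unknown_sets n \<Delta> i \<Longrightarrow> 1 \<le> EFS_given n m v i W"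
    and low: "\<And>\<alpha> A. 1 \<le> \<alpha> \<Longrightarrow> A \<in> allocations n m \<Longrightarrow>
      (\<And>i. i \<in> {1..n} \<Longrightarrow> 1 / \<alpha> \<le> utility m v i (A i)) \<Longrightarrow> 1 / 6 * sqrt \<Delta> \<le> \<alpha>"
    using group_instance_exists[OF n D] by blast
  have "1 / 6 * sqrt \<Delta> \<le> \<alpha>"
    if W: "\<forall>i\<in>{1..n}. W i \<in> unknown_sets n \<Delta> i" and al: "1 \<le> \<alpha>"
      and A: "A \<in> allocations n m"
      and u: "\<forall>i\<in>{1..n}. EFS_given n m v i (W i) / \<alpha> \<le> utility m v i (A i)" for W \<alpha> A
  proof (rule low[OF al A])
    fix i assume i: "i \<in> {1..n}"
    have "1 / \<alpha> \<le> EFS_given n m v i (W i) / \<alpha>"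
      using E[OF i] W i al by (intro divide_right_mono) auto
    thus "1 / \<alpha> \<le> utility m v i (A i)" using u i by force
  qed
  with m v show "\<exists>(m::nat) v. 1 \<le> m \<and> fair_instance n m v \<and>
        (\<forall>W. (\<forall>i\<in>{1..n}. W i \<in> unknown_sets n \<Delta> i) \<longrightarrow>
          (\<forall>(\<alpha>::real) A. 1 \<le> \<alpha> \<and> A \<in> allocations n m \<and>
             (\<forall>i\<in>{1..n}. utility m v i (A i) \<ge> EFS_given n m v i (W i) / \<alpha>) \<longrightarrow>
             \<alpha> \<ge> 1 / 6 * sqrt \<Delta>))" by blast
qed

end
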